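(* Let $A$ be a generalized Cartan matrix with associated data $\mathfrak h_{\mathbb R}^*,\Pi,W,\overline C$, let $\mu\in\overline C$, and let $H$ be the convex hull of $W\mu$. Then the set $\mathcal F$ of fundamental faces of $H$ is a cross-section for the action of $W$ on the set $\mathcal F(H)$ of all faces of $H$; that is, every face of $H$ is $W$-equivalent to a unique fundamental face of $H$.
   Context: Let $A=(a_{ij})_{i,j=1}^m$ be a generalized Cartan matrix (integral, $a_{ii}=2$, $a_{ij}\le 0$ for $i\ne j$, $a_{ij}=0\Rightarrow a_{ji}=0$) of rank $l$. Let $(\mathfrak h_{\mathbb R},\Pi,\Pi^\vee)$ be a realization of $A$ over $\mathbb R$: $\mathfrak h_{\mathbb R}$ is a real vector space of dimension $2m-l$, and $\Pi=\{\alpha_1,\dots,\alpha_m\}\subset\mathfrak h_{\mathbb R}^*$ and $\Pi^\vee=\{\alpha_1^\vee,\dots,\alpha_m^\vee\}\subset\mathfrak h_{\mathbb R}$ are linearly independent with $\langle\alpha_j,\alpha_i^\vee\rangle=a_{ij}$. The Weyl group $W\subset GL(\mathfrak h_{\mathbb R}^* )$ is generated by the reflections $r_{\alpha_i}(\eta)=\eta-\langle\eta,\alpha_i^\vee\rangle\alpha_i$. The fundamental chamber is $\overline C=\{\eta\in\mathfrak h_{\mathbb R}^*\mid\langle\eta,\alpha^\vee\rangle\ge 0\ \forall\alpha\in\Pi\}$. A face of the convex set $H$ is a convex subset $F\subseteq H$ such that every closed line segment in $H$ having a relative interior point in $F$ has both endpoints in $F$ (so $\emptyset$ and $H$ are faces).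 $\mathcal F(H)$ is the set of all faces; $W$ acts on it by $F\mapsto wF$. A face $F$ is fundamental if $F=\emptyset$ or $\operatorname{ri}(F)\cap\overline C\ne\emptyset$, where $\operatorname{ri}$ denotes relative interior. *)

theory Defs
  imports "HOL-Analysis.Analysis" "HOL-Algebra.Generated_Groups"
begin

definition generalized_cartan_matrix :: "int^'m^'m \<Rightarrow> bool" where
  "generalized_cartan_matrix A \<longleftrightarrow>
     (\<forall>i. A $ i $ i = 2) \<and>
     (\<forall>i j. i \<noteq> j \<longrightarrow> A $ i $ j \<le> 0) \<and>
     (\<forall>i j. A $ i $ j = 0 \<longrightarrow> A $ j $ i = 0)"

text \<open>
  The space \<open>\<hh>\<close> is a type \<open>'h\<close> of class \<open>euclidean_space\<close>, i.e. an arbitrary nonzero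
  finite-dimensional real vector space; its inner product plays no role. The dual is the type
  \<open>'h \<Rightarrow>\<^sub>L real\<close>: in finite dimension all linear functionals are bounded, and the norm topology
  on the dual is the usual one. The pairing of \<open>\<eta>\<close> with \<open>h\<close> is the value \<open>blinfun_apply \<eta> h\<close>.
  Since \<open>\<alpha>\<close> and \<open>\<alpha>v\<close> are families, linear independence comprises injectivity.
\<close>

definition realization ::
  "int^'m^'m \<Rightarrow> ('m \<Rightarrow> 'h::euclidean_space \<Rightarrow>\<^sub>L real) \<Rightarrow> ('m \<Rightarrow> 'h) \<Rightarrow> bool" where
  "realization A \<alpha> \<alpha>v \<longleftrightarrow>
     DIM('h) = 2 * CARD('m) - rank (map_matrix real_of_int A) \<and>
     inj \<alpha> \<and> independent (range \<alpha>) \<and>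
     inj \<alpha>v \<and> independent (range \<alpha>v) \<and>
     (\<forall>i j. blinfun_apply (\<alpha> j) (\<alpha>v i) = real_of_int (A $ i $ j))"

definition general_linear_group :: "('v::real_vector \<Rightarrow> 'v) monoid" where
  "general_linear_group = \<lparr>carrier = {f. linear f \<and> bij f}, mult = (\<circ>), one = id\<rparr>"

definition simple_reflection ::
  "('m \<Rightarrow> 'h::euclidean_space \<Rightarrow>\<^sub>L real) \<Rightarrow> ('m \<Rightarrow> 'h) \<Rightarrow> 'm \<Rightarrow> ('h \<Rightarrow>\<^sub>L real) \<Rightarrow> ('h \<Rightarrow>\<^sub>L real)" where
  "simple_reflection \<alpha> \<alpha>v i \<eta> = \<eta> - blinfun_apply \<eta> (\<alpha>v i) *\<^sub>R \<alpha> i"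

definition weyl_group ::
  "('m \<Rightarrow> 'h::euclidean_space \<Rightarrow>\<^sub>L real) \<Rightarrow> ('m \<Rightarrow> 'h) \<Rightarrow> (('h \<Rightarrow>\<^sub>L real) \<Rightarrow> ('h \<Rightarrow>\<^sub>L real)) set" where
  "weyl_group \<alpha> \<alpha>v = generate general_linear_group (range (simple_reflection \<alpha> \<alpha>v))"

definition fundamental_chamber :: "('m \<Rightarrow> 'h::euclidean_space) \<Rightarrow> ('h \<Rightarrow>\<^sub>L real) set" where
  "fundamental_chamber \<alpha>v = {\<eta>. \<forall>i. 0 \<le> blinfun_apply \<eta> (\<alpha>v i)}"

definition weyl_orbit_hull ::
  "('m \<Rightarrow> 'h::euclidean_space \<Rightarrow>\<^sub>L real) \<Rightarrow> ('m \<Rightarrow> 'h) \<Rightarrow> ('h \<Rightarrow>\<^sub>L real) \<Rightarrow> ('h \<Rightarrow>\<^sub>L real) set" where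
  "weyl_orbit_hull \<alpha> \<alpha>v \<mu> = convex hull ((\<lambda>w. w \<mu>) ` weyl_group \<alpha> \<alpha>v)"

definition fundamental_face ::
  "('m \<Rightarrow> 'h::euclidean_space) \<Rightarrow> ('h \<Rightarrow>\<^sub>L real) set \<Rightarrow> ('h \<Rightarrow>\<^sub>L real) set \<Rightarrow> bool" where
  "fundamental_face \<alpha>v H F \<longleftrightarrow>
     F face_of H \<and> (F = {} \<or> rel_interior F \<inter> fundamental_chamber \<alpha>v \<noteq> {})"

lemma group_general_linear_group: "group (general_linear_group :: ('v::real_vector \<Rightarrow> 'v) monoid)"
proof (rule groupI)
  fix f :: "'v \<Rightarrow> 'v" assume "f \<in> carrier general_linear_group"
  then have f: "linear f" "bij f" by (simp_all add: general_linear_group_def)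
  let ?g = "inv_into UNIV f"
  have fg: "f (?g x) = x" and gf: "?g (f x) = x" for x
    using f(2) by (simp_all add: bij_is_surj surj_f_inv_f bij_is_inj)
  have "linear ?g"
  proof (rule linearI)
    show "?g (x + y) = ?g x + ?g y" for x y
      using gf[of "?g x + ?g y"] by (simp add: linear_add[OF f(1)] fg)
    show "?g (c *\<^sub>R x) = c *\<^sub>R ?g x" for c x
      using gf[of "c *\<^sub>R ?g x"] by (simp add: linear_scale[OF f(1)] fg)
  qed
  then show "\<exists>g\<in>carrier general_linear_group.
      g \<otimes>\<^bsub>general_linear_group\<^esub> f = \<one>\<^bsub>general_linear_group\<^esub>"
    using bij_imp_bij_inv[OF f(2)] gf
    by (intro bexI[of _ ?g]) (simp_all add: general_linear_group_def fun_eq_iff)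
qed (simp_all add: general_linear_group_def linear_compose bij_comp linear_id o_assoc)

lemma simple_reflection_in_GL:
  assumes "generalized_cartan_matrix A" and "realization A \<alpha> \<alpha>v"
  shows "simple_reflection \<alpha> \<alpha>v i \<in> carrier general_linear_group"
proof -
  let ?r = "simple_reflection \<alpha> \<alpha>v i"
  have "blinfun_apply (\<alpha> i) (\<alpha>v i) = 2"
    using assms by (simp add: generalized_cartan_matrix_def realization_def)
  then have "?r (?r \<eta>) = \<eta>" for \<eta>
    by (simp add: simple_reflection_def blinfun.diff_left blinfun.scaleR_left scaleR_left_diff_distrib
        flip: scaleR_2)
  then have "bij ?r" by (intro o_bij[of ?r]) auto
  moreover have "linear ?r"
    by (rule linearI) (simp_all add: simple_reflection_def blinfun.add_left blinfun.scaleR_left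
        algebra_simps)
  ultimately show ?thesis by (simp add: general_linear_group_def)
qed

end

theory Submission
  imports Defs
begin

text \<open>
  For dominant \<open>x\<close> and \<open>w \<in> W\<close>, positivity of roots writes \<open>x - w x\<close> as a combination of elements of
  the positive root cone with the coefficients \<open>\<langle>x, \<alpha>\<^sub>i\<^sup>\<or>\<rangle>\<close>. Hence distinct dominant points are never
  conjugate, and for \<open>x \<in> H\<close> the heights of \<open>\<mu> - w x\<close> (\<open>w \<in> W\<close>) form a locally finite set of
  non-negative reals. Minimising the height over the orbit of a relative interior point of a face
  gives a dominant conjugate, hence a fundamental face in the orbit.

  For uniqueness let \<open>G\<close> and \<open>G' = w G\<close> be fundamental, with dominant \<open>x \<in> ri G\<close> and \<open>x' \<in> ri G'\<close>. If
  \<open>z \<in> ri G'\<close> is negative on \<open>\<alpha>\<^sub>i\<^sup>\<or>\<close>, the segment from \<open>z\<close> to \<open>x'\<close> meets the reflecting hyperplane inside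
  \<open>ri G'\<close>, so \<open>G'\<close> and its reflection share a relative interior point and coincide. Hence minimising
  the height over the stabiliser of \<open>G'\<close> moves \<open>w x\<close> to a dominant point of \<open>ri G'\<close>. That point is
  conjugate to \<open>x\<close>, hence equal to \<open>x\<close>, and \<open>G = G'\<close>.
\<close>

section \<open>Relative interiors in the dual space\<close>

lemma rel_interior_linear_iso_subset:
  fixes f :: "'a::real_normed_vector \<Rightarrow> 'b::real_normed_vector"
  assumes f: "bounded_linear f" and g: "bounded_linear g"
    and gf: "\<And>x. g (f x) = x" and fg: "\<And>y. f (g y) = y"
  shows "f ` rel_interior S \<subseteq> rel_interior (f ` S)"
proof
  fix y assume "y \<in> f ` rel_interior S"
  then obtain x T where x: "y = f x" "open T" "x \<in> T" "x \<in> S" "T \<inter> affine hull S \<subseteq> S"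
    by (auto simp: mem_rel_interior)
  have "f ` T = g -` T"
    using gf fg by (auto simp: image_iff) (metis fg)
  then have "open (f ` T)"
    using x(2) linear_continuous_on[OF g] by (metis open_vimage)
  moreover have "f ` T \<inter> affine hull (f ` S) \<subseteq> f ` S"
  proof -
    have "affine hull (f ` S) = f ` (affine hull S)"
      by (simp add: affine_hull_linear_image f)
    moreover have "inj f" using gf by (metis injI)
    ultimately show ?thesis using x(5) by (metis image_Int image_mono)
  qed
  ultimately show "y \<in> rel_interior (f ` S)"
    using x by (auto simp: mem_rel_interior intro!: exI[of _ "f ` T"])
qed

lemma rel_interior_linear_iso:
  fixes f :: "'a::real_normed_vector \<Rightarrow> 'b::real_normed_vector"
  assumes f: "bounded_linear f" and g: "bounded_linear g"
    and gf: "\<And>x. g (f x) = x" and fg: "\<And>y. f (g y) = y"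
  shows "rel_interior (f ` S) = f ` rel_interior S"
proof
  have "g ` rel_interior (f ` S) \<subseteq> rel_interior (g ` f ` S)"
    using assms by (intro rel_interior_linear_iso_subset) auto
  also have "g ` f ` S = S" using gf by (simp add: image_image)
  finally have "f ` g ` rel_interior (f ` S) \<subseteq> f ` rel_interior S" by (rule image_mono)
  then show "rel_interior (f ` S) \<subseteq> f ` rel_interior S" using fg by (simp add: image_image)
qed (rule rel_interior_linear_iso_subset[OF assms])

text \<open>\<open>g\<close> is the Riesz isomorphism; the coordinates of \<open>g y\<close> are the
  values of \<open>y\<close> on the basis.\<close>

lemma dual_euclidean_iso:
  obtains g :: "('h::euclidean_space \<Rightarrow>\<^sub>L real) \<Rightarrow> 'h" where
    "bounded_linear g" "\<And>x. g (blinfun_inner_left x) = x" "\<And>y. blinfun_inner_left (g y) = y"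
proof
  let ?g = "\<lambda>y::'h \<Rightarrow>\<^sub>L real. \<Sum>b\<in>Basis. blinfun_apply y b *\<^sub>R b"
  show "bounded_linear ?g" by (intro bounded_linear_intros)
  show "?g (blinfun_inner_left x) = x" for x
    by (simp add: inner_commute[of _ x] euclidean_representation)
  show "blinfun_inner_left (?g y) = y" for y
    by (rule blinfun_euclidean_eqI) (simp add: inner_sum_right inner_Basis if_distrib sum.delta cong: if_cong)
qed

text \<open>Both facts are carried over from \<open>'h\<close> along the isomorphism just built,
  since the dual is not itself an instance of \<open>euclidean_space\<close>.\<close>

lemma
  fixes S :: "('h::euclidean_space \<Rightarrow>\<^sub>L real) set"
  assumes "convex S"
  shows convex_rel_interior_dual: "convex (rel_interior S)"
    and rel_interior_eq_empty_dual: "rel_interior S = {} \<longleftrightarrow> S = {}"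
proof -
  obtain g :: "('h \<Rightarrow>\<^sub>L real) \<Rightarrow> 'h" where g: "bounded_linear g"
    "\<And>x. g (blinfun_inner_left x) = x" "\<And>y. blinfun_inner_left (g y) = y"
    by (rule dual_euclidean_iso[where 'h='h]) (rule that)
  have conv: "convex (g ` S)"
    using assms g(1) by (simp add: bounded_linear.linear convex_linear_image)
  have "S = blinfun_inner_left ` g ` S" using g(3) by (simp add: image_image)
  then have eq: "rel_interior S = blinfun_inner_left ` rel_interior (g ` S)"
    using rel_interior_linear_iso[OF bounded_linear_blinfun_inner_left g] by metis
  show "convex (rel_interior S)"
    unfolding eq
    by (intro convex_linear_image bounded_linear.linear[OF bounded_linear_blinfun_inner_left]
        convex_rel_interior conv)
  show "rel_interior S = {} \<longleftrightarrow> S = {}"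
    unfolding eq using rel_interior_eq_empty[OF conv] by simp
qed

section \<open>Locally finite sets of non-negative reals\<close>

text \<open>This notion yields minima and survives sumsets and non-negative scaling, so it passes
  from the orbit of \<mu> to convex combinations.\<close>

definition locally_finite_nonneg :: "real set \<Rightarrow> bool" where
  "locally_finite_nonneg S \<longleftrightarrow> S \<subseteq> {0..} \<and> (\<forall>B. finite (S \<inter> {..B}))"

lemma locally_finite_nonneg_subset:
  "locally_finite_nonneg T \<Longrightarrow> S \<subseteq> T \<Longrightarrow> locally_finite_nonneg S"
  unfolding locally_finite_nonneg_def by (meson Int_mono finite_subset order_refl order_trans)

lemma locally_finite_nonneg_has_min:
  assumes "locally_finite_nonneg S" "S \<noteq> {}"
  obtains x where "x \<in> S" "\<And>y. y \<in> S \<Longrightarrow> x \<le> y"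
proof -
  obtain b where b: "b \<in> S" using assms by auto
  let ?T = "S \<inter> {..b}"
  have T: "finite ?T" "?T \<noteq> {}" using assms b by (auto simp: locally_finite_nonneg_def)
  show ?thesis
  proof
    show "Min ?T \<in> S" using Min_in[OF T] by simp
    fix y assume y: "y \<in> S"
    show "Min ?T \<le> y"
    proof (cases "y \<le> b")
      case True then show ?thesis using T y by simp
    next
      case False
      then show ?thesis using Min_in[OF T] by simp
    qed
  qed
qed

text \<open>As both summands are non-negative, a bound on the sum bounds each of them, leaving
  finitely many pairs.\<close>

lemma locally_finite_nonneg_add:
  assumes "locally_finite_nonneg S" "locally_finite_nonneg T"
  shows "locally_finite_nonneg {s + t | s t. s \<in> S \<and> t \<in> T}"
  unfolding locally_finite_nonneg_def
proof (intro conjI allI)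
  show "{s + t |s t. s \<in> S \<and> t \<in> T} \<subseteq> {0..}"
    using assms by (force simp: locally_finite_nonneg_def)
  fix B
  have "{s + t |s t. s \<in> S \<and> t \<in> T} \<inter> {..B} \<subseteq> (\<lambda>(s, t). s + t) ` ((S \<inter> {..B}) \<times> (T \<inter> {..B}))"
    using assms by (force simp: locally_finite_nonneg_def)
  moreover have "finite \<dots>" using assms by (auto simp: locally_finite_nonneg_def)
  ultimately show "finite ({s + t |s t. s \<in> S \<and> t \<in> T} \<inter> {..B})" by (rule finite_subset)
qed

lemma locally_finite_nonneg_scale:
  assumes S: "locally_finite_nonneg S" and "0 \<le> c"
  shows "locally_finite_nonneg ((*) c ` S)"
proof (cases "c = 0")
  case True
  then have "(*) c ` S \<subseteq> {0}" by auto
  moreover have "locally_finite_nonneg {0}" by (auto simp: locally_finite_nonneg_def)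
  ultimately show ?thesis by (metis locally_finite_nonneg_subset)
next
  case False
  with \<open>0 \<le> c\<close> have c: "0 < c" by simp
  show ?thesis unfolding locally_finite_nonneg_def
  proof (intro conjI allI)
    show "(*) c ` S \<subseteq> {0..}" using S c by (auto simp: locally_finite_nonneg_def)
    fix B
    have "(*) c ` S \<inter> {..B} \<subseteq> (*) c ` (S \<inter> {..B / c})"
      using c by (auto simp: field_simps)
    then show "finite ((*) c ` S \<inter> {..B})"
      using S by (meson finite_imageI finite_subset locally_finite_nonneg_def)
  qed
qed

lemma locally_finite_nonneg_nat_combinations:
  assumes "finite J" "\<And>j. j \<in> J \<Longrightarrow> 0 \<le> m j"
  shows "locally_finite_nonneg (range (\<lambda>N::'a \<Rightarrow> nat. \<Sum>j\<in>J. m j * real (N j)))"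
  using assms
proof (induction J)
  case empty
  then show ?case by (auto simp: locally_finite_nonneg_def)
next
  case (insert a J)
  have "locally_finite_nonneg (range real)"
    unfolding locally_finite_nonneg_def
  proof (intro conjI allI)
    fix B :: real
    have "range real \<inter> {..B} \<subseteq> real ` {..nat \<lfloor>B\<rfloor>}" by (auto simp: le_nat_floor)
    then show "finite (range real \<inter> {..B})" by (meson finite_atMost finite_imageI finite_subset)
  qed auto
  then have "locally_finite_nonneg ((*) (m a) ` range real)"
    using insert.prems by (intro locally_finite_nonneg_scale) auto
  then have "locally_finite_nonneg {s + t |s t. s \<in> (*) (m a) ` range real \<and>
      t \<in> range (\<lambda>N::'a \<Rightarrow> nat. \<Sum>j\<in>J. m j * real (N j))}"
    using insert by (intro locally_finite_nonneg_add) auto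
  then show ?case
  proof (rule locally_finite_nonneg_subset, intro subsetI)
    fix x assume "x \<in> range (\<lambda>N::'a \<Rightarrow> nat. \<Sum>j\<in>insert a J. m j * real (N j))"
    then obtain N where "x = m a * real (N a) + (\<Sum>j\<in>J. m j * real (N j))"
      using insert.hyps by auto
    then show "x \<in> {s + t |s t. s \<in> (*) (m a) ` range real \<and>
        t \<in> range (\<lambda>N::'a \<Rightarrow> nat. \<Sum>j\<in>J. m j * real (N j))}" by blast
  qed
qed

section \<open>Reflection words\<close>

text \<open>The word grows at its head and always ends in \<open>j\<close>. Under
  \<open>foldr s\<close> the last letter acts first, so applied to \<open>\<alpha> i\<close> it
  starts with the reflection in \<open>j\<close>.\<close>

primrec alternating_word :: "'m \<Rightarrow> 'm \<Rightarrow> nat \<Rightarrow> 'm list" where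
  "alternating_word i j 0 = []"
| "alternating_word i j (Suc n) = (if even n then j else i) # alternating_word i j n"

lemma length_alternating_word [simp]: "length (alternating_word i j n) = n"
  by (induction n) auto

lemma alternating_word_snoc: "alternating_word i j n @ [i] = alternating_word j i (Suc n)"
  by (induction n) auto

text \<open>Appending \<open>i\<close> forces the last letter of \<open>u\<close> to be
  \<open>j\<close>, and gives the empty word a head to compare with in the induction.\<close>

lemma alternating_wordI:
  assumes "set u \<subseteq> {i, j}" "distinct_adj (u @ [i])"
  shows "u = alternating_word i j (length u)"
  using assms
proof (induction u)
  case (Cons a u)
  then have u: "u = alternating_word i j (length u)"
    by (auto simp: distinct_adj_Cons)
  have "hd (alternating_word i j n @ [i]) = (if even n then i else j)" for n
    by (cases n) auto
  then have "hd (u @ [i]) = (if even (length u) then i else j)" using u by metis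
  moreover have "a \<noteq> hd (u @ [i])" using Cons.prems by (auto simp: distinct_adj_Cons)
  ultimately show ?case using u Cons.prems by auto
qed simp

lemma not_distinct_adj_decomp:
  "\<not> distinct_adj xs \<Longrightarrow> \<exists>p a q. xs = p @ [a, a] @ q"
proof (induction xs)
  case (Cons x xs)
  show ?case
  proof (cases "distinct_adj xs")
    case True
    with Cons.prems have "xs \<noteq> []" "x = hd xs" by (auto simp: distinct_adj_Cons)
    then show ?thesis by (intro exI[of _ "[]"]) (auto simp: neq_Nil_conv)
  next
    case False
    then show ?thesis using Cons.IH by (metis append_Cons)
  qed
qed simp

section \<open>The Weyl group as words in simple reflections\<close>

locale gcm_realization =
  fixes A :: "int^'m^'m"
    and \<alpha> :: "'m \<Rightarrow> 'h::euclidean_space \<Rightarrow>\<^sub>L real"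
    and \<alpha>v :: "'m \<Rightarrow> 'h"
  assumes gcm: "generalized_cartan_matrix A"
    and realization: "realization A \<alpha> \<alpha>v"
begin

abbreviation s :: "'m \<Rightarrow> ('h \<Rightarrow>\<^sub>L real) \<Rightarrow> ('h \<Rightarrow>\<^sub>L real)" where
  "s \<equiv> simple_reflection \<alpha> \<alpha>v"

lemma \<alpha>_\<alpha>v: "blinfun_apply (\<alpha> j) (\<alpha>v i) = real_of_int (A $ i $ j)"
  using realization by (simp add: realization_def)

lemma A_diag [simp]: "A $ i $ i = 2"
  using gcm by (simp add: generalized_cartan_matrix_def)

lemma A_off_diag: "i \<noteq> j \<Longrightarrow> A $ i $ j \<le> 0"
  using gcm by (simp add: generalized_cartan_matrix_def)

lemma A_eq_0_commute: "A $ i $ j = 0 \<longleftrightarrow> A $ j $ i = 0"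
  using gcm by (auto simp: generalized_cartan_matrix_def)

lemma s_s [simp]: "s i (s i x) = x"
  by (simp add: simple_reflection_def blinfun.diff_left blinfun.scaleR_left \<alpha>_\<alpha>v algebra_simps
      flip: scaleR_2)

lemma s_o_s [simp]: "s i \<circ> s i = id" "s i \<circ> (s i \<circ> f) = f"
  by (auto simp: fun_eq_iff)

lemma bounded_linear_s: "bounded_linear (s i)"
  unfolding simple_reflection_def by (intro bounded_linear_intros)

lemma bounded_linear_word: "bounded_linear (foldr s xs)"
proof (induction xs)
  case Nil
  show ?case by (simp add: id_def bounded_linear_ident)
next
  case (Cons a xs)
  then show ?case using bounded_linear_compose[OF bounded_linear_s Cons] by (simp add: o_def)
qed

lemma linear_word: "linear (foldr s xs)"
  by (rule bounded_linear.linear[OF bounded_linear_word])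

lemma rev_word_word [simp]: "foldr s (rev xs) (foldr s xs x) = x"
  by (induction xs arbitrary: x) auto

lemma word_rev_word [simp]: "foldr s xs (foldr s (rev xs) x) = x"
  using rev_word_word[of "rev xs"] by simp

text \<open>The generators are involutions, so inverses contribute no new products.\<close>

lemma weyl_group_eq: "weyl_group \<alpha> \<alpha>v = range (foldr s)"
proof
  interpret GL: group "general_linear_group :: (('h \<Rightarrow>\<^sub>L real) \<Rightarrow> ('h \<Rightarrow>\<^sub>L real)) monoid"
    by (rule group_general_linear_group)
  have refl_GL: "s i \<in> carrier general_linear_group" for i
    by (rule simple_reflection_in_GL[OF gcm realization])
  have inv_s: "inv\<^bsub>general_linear_group\<^esub> s i = s i" for i
    by (rule GL.inv_equality) (auto simp: refl_GL, simp add: general_linear_group_def)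
  show "weyl_group \<alpha> \<alpha>v \<subseteq> range (foldr s)"
  proof
    fix w assume "w \<in> weyl_group \<alpha> \<alpha>v"
    then show "w \<in> range (foldr s)" unfolding weyl_group_def
    proof (induction rule: generate.induct)
      case one
      show ?case by (rule range_eqI[of _ _ "[]"]) (simp add: general_linear_group_def id_def)
    next
      case (incl h)
      then obtain i where "h = s i" by auto
      then show ?case by (intro range_eqI[of _ _ "[i]"]) simp
    next
      case (inv h)
      then obtain i where "h = s i" by auto
      then show ?case using inv_s by (intro range_eqI[of _ _ "[i]"]) simp
    next
      case (eng h1 h2)
      then obtain xs ys where "h1 = foldr s xs" "h2 = foldr s ys" by auto
      then show ?case
        by (intro range_eqI[of _ _ "xs @ ys"]) (simp add: general_linear_group_def)
    qed
  qed
  show "range (foldr s) \<subseteq> weyl_group \<alpha> \<alpha>v"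
  proof
    fix w assume "w \<in> range (foldr s)"
    then obtain xs where "w = foldr s xs" by auto
    moreover have "foldr s xs \<in> weyl_group \<alpha> \<alpha>v"
    proof (induction xs)
      case Nil
      show ?case using generate.one[of "general_linear_group" "range s"]
        by (simp add: weyl_group_def general_linear_group_def id_def)
    next
      case (Cons a xs)
      have "s a \<in> generate general_linear_group (range s)" by (rule generate.incl) simp
      from generate.eng[OF this Cons[unfolded weyl_group_def]] show ?case
        by (simp add: weyl_group_def general_linear_group_def comp_def)
    qed
    ultimately show "w \<in> weyl_group \<alpha> \<alpha>v" by simp
  qed
qed

section \<open>Positivity of roots\<close>

text \<open>Coefficients are natural numbers rather than non-negative reals: integrality is what
  later makes the heights locally finite.\<close>

definition root_cone :: "('h \<Rightarrow>\<^sub>L real) set" where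
  "root_cone = range (\<lambda>n::'m \<Rightarrow> nat. \<Sum>i\<in>UNIV. real (n i) *\<^sub>R \<alpha> i)"

lemma root_cone_0: "0 \<in> root_cone"
  unfolding root_cone_def by (rule range_eqI[of _ _ "\<lambda>_. 0"]) simp

lemma root_cone_\<alpha>: "\<alpha> i \<in> root_cone"
  unfolding root_cone_def
proof (rule range_eqI[of _ _ "\<lambda>j. if j = i then 1 else 0"])
  have "(\<Sum>j\<in>UNIV. real (if j = i then 1 else 0) *\<^sub>R \<alpha> j) = (\<Sum>j\<in>UNIV. if j = i then \<alpha> j else 0)"
    by (intro sum.cong) auto
  then show "\<alpha> i = (\<Sum>j\<in>UNIV. real (if j = i then 1 else 0) *\<^sub>R \<alpha> j)" by simp
qed

lemma root_cone_add: "x \<in> root_cone \<Longrightarrow> y \<in> root_cone \<Longrightarrow> x + y \<in> root_cone"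
  unfolding root_cone_def
proof safe
  fix n k :: "'m \<Rightarrow> nat"
  show "(\<Sum>i\<in>UNIV. real (n i) *\<^sub>R \<alpha> i) + (\<Sum>i\<in>UNIV. real (k i) *\<^sub>R \<alpha> i)
      \<in> range (\<lambda>n. \<Sum>i\<in>UNIV. real (n i) *\<^sub>R \<alpha> i)"
    by (rule range_eqI[of _ _ "\<lambda>i. n i + k i"]) (simp add: scaleR_add_left sum.distrib)
qed

lemma root_cone_scale: "x \<in> root_cone \<Longrightarrow> real p *\<^sub>R x \<in> root_cone"
  by (induction p) (auto simp: root_cone_0 scaleR_add_left root_cone_add)

section \<open>Roots for two simple reflections\<close>

definition rank2_positive :: "'m \<Rightarrow> 'm \<Rightarrow> nat \<Rightarrow> bool" where
  "rank2_positive i j k \<longleftrightarrow> (\<exists>p q::nat.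
     foldr s (alternating_word i j k) (\<alpha> i) = real p *\<^sub>R \<alpha> i + real q *\<^sub>R \<alpha> j)"

lemma s_rank2:
  "s i (x + p *\<^sub>R \<alpha> i + q *\<^sub>R \<alpha> j) =
     x + (- p - blinfun_apply x (\<alpha>v i) - q * A $ i $ j) *\<^sub>R \<alpha> i + q *\<^sub>R \<alpha> j"
  "s j (x + p *\<^sub>R \<alpha> i + q *\<^sub>R \<alpha> j) =
     x + p *\<^sub>R \<alpha> i + (- q - blinfun_apply x (\<alpha>v j) - p * A $ j $ i) *\<^sub>R \<alpha> j"
  by (simp_all add: simple_reflection_def blinfun.add_left blinfun.scaleR_left \<alpha>_\<alpha>v algebra_simps
      flip: scaleR_2)

lemma s_rank2_root:
  "s i (p *\<^sub>R \<alpha> i + q *\<^sub>R \<alpha> j) = (- p - q * A $ i $ j) *\<^sub>R \<alpha> i + q *\<^sub>R \<alpha> j"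
  "s j (p *\<^sub>R \<alpha> i + q *\<^sub>R \<alpha> j) = p *\<^sub>R \<alpha> i + (- q - p * A $ j $ i) *\<^sub>R \<alpha> j"
  using s_rank2[where x=0 and p=p and q=q and i=i and j=j] by (simp_all add: blinfun.zero_left)

text \<open>
  With \<open>c = -a\<^sub>i\<^sub>j\<close> and \<open>d = -a\<^sub>j\<^sub>i\<close>, the invariant \<open>2 q \<le> d p\<close> (resp. \<open>2 p \<le> c q\<close>) on the coefficients
  of a root survives each further reflection because \<open>c d \<ge> 4\<close>.
\<close>

lemma rank2_positive_infinite:
  assumes ij: "i \<noteq> j" and A: "A $ i $ j * A $ j $ i \<ge> 4"
  shows "rank2_positive i j k"
proof -
  define c d where "c = - A $ i $ j" and "d = - A $ j $ i"
  have cd: "c \<ge> 0" "d \<ge> 0" "c * d \<ge> 4"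
    using A A_off_diag[of i j] A_off_diag[of j i] ij by (auto simp: c_def d_def)
  have step: "2 * p \<le> e' * (e * p - q) \<and> q \<le> e * p - q"
    if "e' \<ge> 0" "e * e' \<ge> 4" "2 * q \<le> e * p" "0 \<le> p" for p q e e' :: int
  proof
    have "4 * p \<le> e * e' * p" using that by (intro mult_right_mono)
    moreover have "e' * (2 * q) \<le> e' * (e * p)" using that by (intro mult_left_mono)
    ultimately show "2 * p \<le> e' * (e * p - q)" by (simp add: algebra_simps)
    show "q \<le> e * p - q" using that by simp
  qed
  have "\<exists>p q::int. p \<ge> 0 \<and> q \<ge> 0 \<and> (if even k then 2 * q \<le> d * p else 2 * p \<le> c * q) \<and>
     foldr s (alternating_word i j k) (\<alpha> i) = of_int p *\<^sub>R \<alpha> i + of_int q *\<^sub>R \<alpha> j"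
  proof (induction k)
    case 0
    show ?case using cd by (intro exI[of _ 1] exI[of _ 0]) auto
  next
    case (Suc k)
    then obtain p q :: int where pq: "p \<ge> 0" "q \<ge> 0"
      "if even k then 2 * q \<le> d * p else 2 * p \<le> c * q"
      "foldr s (alternating_word i j k) (\<alpha> i) = of_int p *\<^sub>R \<alpha> i + of_int q *\<^sub>R \<alpha> j" by blast
    show ?case
    proof (cases "even k")
      case True
      then show ?thesis using pq cd step[of c d q p]
        by (intro exI[of _ p] exI[of _ "d * p - q"])
          (auto simp: s_rank2_root d_def algebra_simps)
    next
      case False
      then show ?thesis using pq cd step[of d c p q]
        by (intro exI[of _ "c * q - p"] exI[of _ q])
          (auto simp: s_rank2_root c_def algebra_simps)
    qed
  qed
  then obtain p q :: int where "p \<ge> 0" "q \<ge> 0"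
    "foldr s (alternating_word i j k) (\<alpha> i) = of_int p *\<^sub>R \<alpha> i + of_int q *\<^sub>R \<alpha> j" by blast
  then show ?thesis
    unfolding rank2_positive_def by (intro exI[of _ "nat p"] exI[of _ "nat q"]) simp
qed

text \<open>These are the finite types, where two reflections generate a dihedral group. The braid
  relation and the positive roots are found by direct evaluation, type by type.\<close>

lemma rank2_braid_finite:
  assumes ij: "i \<noteq> j" and A: "A $ i $ j * A $ j $ i < 4"
  obtains m where "m > 0"
    "foldr s (alternating_word i j m) = foldr s (alternating_word j i m)"
    "\<And>k. k < m \<Longrightarrow> rank2_positive i j k"
proof -
  define c d where "c = - A $ i $ j" and "d = - A $ j $ i"
  have nonneg: "c \<ge> 0" "d \<ge> 0"
    using A_off_diag[of i j] A_off_diag[of j i] ij by (auto simp: c_def d_def)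
  have zero: "c = 0 \<longleftrightarrow> d = 0" using A_eq_0_commute[of i j] by (simp add: c_def d_def)
  have prod: "c * d < 4" using A by (simp add: c_def d_def)
  have Aij: "A $ i $ j = - c" "A $ j $ i = - d" by (simp_all add: c_def d_def)
  \<comment> \<open>Either both entries vanish or both are at least 1; in the latter case each is
    bounded by the product, hence by 3.\<close>
  have cases: "(c, d) \<in> {(0,0), (1,1), (1,2), (2,1), (1,3), (3,1)}"
  proof (cases "c = 0")
    case False
    then have cd: "c \<ge> 1" "d \<ge> 1" using nonneg zero by linarith+
    then have "c \<le> c * d" "d \<le> c * d" by (simp_all add: mult_le_cancel_left1 mult_le_cancel_right1)
    then have "c \<le> 3" "d \<le> 3" using prod by linarith+
    then have "c \<in> {1,2,3}" "d \<in> {1,2,3}" using cd by auto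
    then show ?thesis using prod by auto
  qed (use zero in auto)
  have aw: "alternating_word a b (numeral n) =
      (if even (pred_numeral n) then b else a) # alternating_word a b (pred_numeral n)" for a b :: 'm and n
    by (subst numeral_eq_Suc) simp
  have words: "alternating_word a b 2 = [a, b]" "alternating_word a b 3 = [b, a, b]"
    "alternating_word a b 4 = [a, b, a, b]" "alternating_word a b 5 = [b, a, b, a, b]"
    "alternating_word a b 6 = [a, b, a, b, a, b]" for a b :: 'm
    by (simp_all add: aw)
  have cong: "x + p *\<^sub>R \<alpha> i + q *\<^sub>R \<alpha> j = x + p' *\<^sub>R \<alpha> i + q' *\<^sub>R \<alpha> j"
    if "p = p'" "q = q'" for x p q p' q' using that by simp
  \<comment> \<open>The zero coefficients below are kept, so that both reflections act on one normal form.\<close>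
  note eval = words foldr.simps o_apply id_apply Aij
    s_rank2[where i = i and j = j] s_rank2_root[where i = i and j = j]
  have braid: "foldr s (alternating_word i j m) = foldr s (alternating_word j i m)"
    if "\<And>x. foldr s (alternating_word i j m) (x + 0 *\<^sub>R \<alpha> i + 0 *\<^sub>R \<alpha> j) =
      foldr s (alternating_word j i m) (x + 0 *\<^sub>R \<alpha> i + 0 *\<^sub>R \<alpha> j)" for m
    using that by (simp add: fun_eq_iff)
  have pos: "rank2_positive i j k"
    if "foldr s (alternating_word i j k) (1 *\<^sub>R \<alpha> i + 0 *\<^sub>R \<alpha> j) = real p *\<^sub>R \<alpha> i + real q *\<^sub>R \<alpha> j"
    for k p q
    using that unfolding rank2_positive_def by (intro exI[of _ p] exI[of _ q]) simp
  have below: "k = 0 \<or> k = 1 \<or> k = 2 \<or> k = 3 \<or> k = 4 \<or> k = 5" if "k < 6" for k :: nat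
    using that by auto
  have pos0: "rank2_positive i j 0" by (rule pos[of _ 1 0]) simp
  have pos1: "rank2_positive i j 1"
    by (rule pos[of _ 1 "nat d"]) (use nonneg ij in \<open>simp add: simple_reflection_def \<alpha>_\<alpha>v Aij\<close>)
  \<comment> \<open>The types are A1 x A1, A2, B2 in both orientations and G2 in both orientations,
    with braid lengths 2, 3, 4 and 6. The numbers given to \<open>pos\<close> are the coordinates of
    the successive roots.\<close>
  consider "c = 0" "d = 0" | "c = 1" "d = 1" | "c = 1" "d = 2" | "c = 2" "d = 1" | "c = 1" "d = 3" | "c = 3" "d = 1"
    using cases by auto
  then show ?thesis
  proof cases
    case 1
    note vals = 1
    show ?thesis
    proof (rule that[of 2])
      show "foldr s (alternating_word i j 2) = foldr s (alternating_word j i 2)"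
        by (rule braid, simp only: eval, rule cong) (use vals in \<open>simp_all add: algebra_simps\<close>)
      show "rank2_positive i j k" if "k < 2" for k
        using that below[of k] pos0 pos1  by auto
    qed simp
  next
    case 2
    note vals = 2
    show ?thesis
    proof (rule that[of 3])
      show "foldr s (alternating_word i j 3) = foldr s (alternating_word j i 3)"
        by (rule braid, simp only: eval, rule cong) (use vals in \<open>simp_all add: algebra_simps\<close>)
      have pos2: "rank2_positive i j 2"
        by (rule pos[of _ 0 1], simp only: eval) (use vals in simp)
      show "rank2_positive i j k" if "k < 3" for k
        using that below[of k] pos0 pos1 pos2 by auto
    qed simp
  next
    case 3
    note vals = 3
    show ?thesis
    proof (rule that[of 4])
      show "foldr s (alternating_word i j 4) = foldr s (alternating_word j i 4)"
        by (rule braid, simp only: eval, rule cong) (use vals in \<open>simp_all add: algebra_simps\<close>)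
      have pos2: "rank2_positive i j 2"
        by (rule pos[of _ 1 2], simp only: eval) (use vals in simp)
      have pos3: "rank2_positive i j 3"
        by (rule pos[of _ 1 0], simp only: eval) (use vals in simp)
      show "rank2_positive i j k" if "k < 4" for k
        using that below[of k] pos0 pos1 pos2 pos3 by auto
    qed simp
  next
    case 4
    note vals = 4
    show ?thesis
    proof (rule that[of 4])
      show "foldr s (alternating_word i j 4) = foldr s (alternating_word j i 4)"
        by (rule braid, simp only: eval, rule cong) (use vals in \<open>simp_all add: algebra_simps\<close>)
      have pos2: "rank2_positive i j 2"
        by (rule pos[of _ 1 1], simp only: eval) (use vals in simp)
      have pos3: "rank2_positive i j 3"
        by (rule pos[of _ 1 0], simp only: eval) (use vals in simp)
      show "rank2_positive i j k" if "k < 4" for k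
        using that below[of k] pos0 pos1 pos2 pos3 by auto
    qed simp
  next
    case 5
    note vals = 5
    show ?thesis
    proof (rule that[of 6])
      show "foldr s (alternating_word i j 6) = foldr s (alternating_word j i 6)"
        by (rule braid, simp only: eval, rule cong) (use vals in \<open>simp_all add: algebra_simps\<close>)
      have pos2: "rank2_positive i j 2"
        by (rule pos[of _ 2 3], simp only: eval) (use vals in simp)
      have pos3: "rank2_positive i j 3"
        by (rule pos[of _ 2 3], simp only: eval) (use vals in simp)
      have pos4: "rank2_positive i j 4"
        by (rule pos[of _ 1 3], simp only: eval) (use vals in simp)
      have pos5: "rank2_positive i j 5"
        by (rule pos[of _ 1 0], simp only: eval) (use vals in simp)
      show "rank2_positive i j k" if "k < 6" for k
        using that below[of k] pos0 pos1 pos2 pos3 pos4 pos5 by auto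
    qed simp
  next
    case 6
    note vals = 6
    show ?thesis
    proof (rule that[of 6])
      show "foldr s (alternating_word i j 6) = foldr s (alternating_word j i 6)"
        by (rule braid, simp only: eval, rule cong) (use vals in \<open>simp_all add: algebra_simps\<close>)
      have pos2: "rank2_positive i j 2"
        by (rule pos[of _ 2 1], simp only: eval) (use vals in simp)
      have pos3: "rank2_positive i j 3"
        by (rule pos[of _ 2 1], simp only: eval) (use vals in simp)
      have pos4: "rank2_positive i j 4"
        by (rule pos[of _ 1 1], simp only: eval) (use vals in simp)
      have pos5: "rank2_positive i j 5"
        by (rule pos[of _ 1 0], simp only: eval) (use vals in simp)
      show "rank2_positive i j k" if "k < 6" for k
        using that below[of k] pos0 pos1 pos2 pos3 pos4 pos5 by auto
    qed simp
  qed
qed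

section \<open>Reduced words and their action on simple roots\<close>

lemma word_append [simp]: "foldr s (xs @ ys) = foldr s xs \<circ> foldr s ys"
  by (simp add: fun_eq_iff)

definition reduced :: "'m list \<Rightarrow> bool" where
  "reduced xs \<longleftrightarrow> (\<forall>ys. foldr s ys = foldr s xs \<longrightarrow> length xs \<le> length ys)"

lemma ex_reduced: "\<exists>ys. reduced ys \<and> foldr s ys = foldr s xs"
proof -
  define ys where "ys = arg_min length (\<lambda>ys. foldr s ys = foldr s xs)"
  have "foldr s ys = foldr s xs" "\<And>zs. foldr s zs = foldr s xs \<Longrightarrow> length ys \<le> length zs"
    unfolding ys_def using arg_min_nat_lemma[of "\<lambda>ys. foldr s ys = foldr s xs" xs length] by auto
  then show ?thesis by (intro exI[of _ ys]) (simp add: reduced_def)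
qed

lemma reduced_appendD: "reduced (xs @ ys) \<Longrightarrow> reduced xs"
  unfolding reduced_def
proof (intro allI impI)
  fix zs assume "\<forall>us. foldr s us = foldr s (xs @ ys) \<longrightarrow> length (xs @ ys) \<le> length us"
    and "foldr s zs = foldr s xs"
  from this(1)[rule_format, of "zs @ ys"] this(2) show "length xs \<le> length zs" by simp
qed

text \<open>In an alternating word of length \<open>Suc m\<close>, the braid relation rewrites the
  last \<open>m\<close> letters so that they begin with the first letter of the word. The two equal
  letters cancel, and further letters on the left do no harm.\<close>

lemma braid_shortens:
  assumes "m > 0" "foldr s (alternating_word i j m) = foldr s (alternating_word j i m)"
  shows "\<exists>ys. foldr s ys = foldr s (alternating_word j i (Suc m + n)) \<and> length ys + 1 = m + n"
proof (induction n)
  case 0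
  obtain m' where m: "m = Suc m'" using assms(1) by (cases m) auto
  have "foldr s (alternating_word j i (Suc m)) =
      s (if even m then i else j) \<circ> foldr s (alternating_word i j m)"
    by (simp add: assms(2))
  also have "\<dots> = foldr s (alternating_word i j m')" by (simp add: m)
  finally show ?case by (intro exI[of _ "alternating_word i j m'"]) (simp add: m)
next
  case (Suc n)
  then obtain ys where "foldr s ys = foldr s (alternating_word j i (Suc m + n))" "length ys + 1 = m + n"
    by blast
  then show ?case
    by (intro exI[of _ "(if even (Suc m + n) then i else j) # ys"]) simp
qed

text \<open>A repeated letter in \<open>u @ [i]\<close>, or a length of \<open>u\<close> reaching
  the braid length, would give a word for \<open>u @ [i]\<close> shorter than \<open>u\<close>. So
  \<open>u\<close> alternates and stays within the range where \<open>rank2_positive\<close> is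
  known.\<close>

lemma rank2_root:
  assumes ij: "i \<noteq> j" and u: "set u \<subseteq> {i, j}"
    and len: "\<And>ys. foldr s ys = foldr s (u @ [i]) \<Longrightarrow> length u \<le> length ys"
  shows "\<exists>p q::nat. foldr s u (\<alpha> i) = real p *\<^sub>R \<alpha> i + real q *\<^sub>R \<alpha> j"
proof -
  have "distinct_adj (u @ [i])"
  proof (rule ccontr)
    assume "\<not> distinct_adj (u @ [i])"
    then obtain p a q where eq: "u @ [i] = p @ [a, a] @ q" using not_distinct_adj_decomp by blast
    have "length (u @ [i]) = length p + 2 + length q" unfolding eq by simp
    moreover have "foldr s (p @ q) = foldr s (u @ [i])" unfolding eq by simp
    ultimately show False using len[of "p @ q"] by simp
  qed
  with u have alt: "u = alternating_word i j (length u)" by (rule alternating_wordI)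
  have "rank2_positive i j (length u)"
  proof (cases "A $ i $ j * A $ j $ i \<ge> 4")
    case True
    with ij show ?thesis by (rule rank2_positive_infinite)
  next
    case False
    then obtain m where m: "m > 0"
      "foldr s (alternating_word i j m) = foldr s (alternating_word j i m)"
      "\<And>k. k < m \<Longrightarrow> rank2_positive i j k"
      using rank2_braid_finite[OF ij] by auto
    have "length u < m"
    proof (rule ccontr)
      assume "\<not> length u < m"
      then obtain n where n: "length u = m + n" using le_Suc_ex by (metis not_less)
      obtain ys where ys: "foldr s ys = foldr s (alternating_word j i (Suc m + n))" "length ys + 1 = m + n"
        using braid_shortens[OF m(1,2)] by blast
      have "u @ [i] = alternating_word j i (Suc m + n)"
        using alternating_word_snoc[of i j "length u"] alt n by simp
      then show False using len[of ys] ys n by simp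
    qed
    with m(3) show ?thesis by simp
  qed
  then show ?thesis using alt by (simp add: rank2_positive_def)
qed

text \<open>Induction on length through rank two. The second hypothesis is the weak inequality l(w
  s_i) >= l(w): its negation is the strict drop needed for minimality below, so no parity argument
  for lengths enters.\<close>

lemma root_positive:
  assumes "reduced xs" "\<And>ys. foldr s ys = foldr s (xs @ [i]) \<Longrightarrow> length xs \<le> length ys"
  shows "foldr s xs (\<alpha> i) \<in> root_cone"
  using assms
proof (induction "length xs" arbitrary: xs i rule: less_induct)
  case less
  show ?case
  proof (cases xs rule: rev_cases)
    case Nil
    then show ?thesis by (simp add: root_cone_\<alpha>)
  next
    case (snoc zs j)
    have ij: "i \<noteq> j"
    proof
      assume "i = j"
      then have "foldr s zs = foldr s (xs @ [i])" using snoc by simp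
      from less.prems(2)[OF this] show False using snoc by simp
    qed
    \<comment> \<open>Split off a maximal suffix in the letters \<open>i, j\<close>: the remaining prefix is then a minimal
      coset representative, to which the induction hypothesis applies for both letters.\<close>
    define P where "P = (\<lambda>(v, u). set u \<subseteq> {i, j} \<and> foldr s (v @ u) = foldr s xs \<and> length v + length u = length xs)"
    \<comment> \<open>This splitting makes the minimal prefix strictly shorter than
      \<open>xs\<close>, as the induction requires.\<close>
    have P0: "P (zs, [j])" by (simp add: P_def snoc)
    obtain v u where vu: "P (v, u)" and min: "\<And>v' u'. P (v', u') \<Longrightarrow> length v \<le> length v'"
      using arg_min_nat_lemma[of P _ "length \<circ> fst", OF P0]
      by (metis comp_apply fst_conv surj_pair)
    have u: "set u \<subseteq> {i, j}" and eq: "foldr s (v @ u) = foldr s xs"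
      and len: "length v + length u = length xs"
      using vu by (auto simp: P_def)
    have short: "length xs \<le> length ys" if "foldr s ys = foldr s xs" for ys
      using less.prems(1) that by (simp add: reduced_def)
    have v_less: "length v < length xs" using min[OF P0] snoc by simp
    have v_reduced: "reduced v"
      unfolding reduced_def
    proof (intro allI impI)
      fix ys assume "foldr s ys = foldr s v"
      then have "foldr s (ys @ u) = foldr s xs" using eq by simp
      from short[OF this] show "length v \<le> length ys" using len by simp
    qed
    have v_cone: "foldr s v (\<alpha> k) \<in> root_cone" if k: "k \<in> {i, j}" for k
    proof (rule less.hyps[OF v_less v_reduced])
      fix ys assume ys: "foldr s ys = foldr s (v @ [k])"
      show "length v \<le> length ys"
      proof (rule ccontr)
        assume *: "\<not> length v \<le> length ys"
        have eq': "foldr s (ys @ k # u) = foldr s xs" using ys eq by (simp add: comp_assoc)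
        \<comment> \<open>With \<open>length ys < length v\<close> this becomes an equality, so the
          lengths add up exactly as \<open>P\<close> demands and \<open>ys\<close> contradicts the
          minimality of \<open>v\<close>.\<close>
        from short[OF this] have "length xs \<le> length ys + 1 + length u" by simp
        then have "P (ys, k # u)" using * len eq' k u by (simp add: P_def)
        from min[OF this] * show False by simp
      qed
    qed
    have "\<exists>p q::nat. foldr s u (\<alpha> i) = real p *\<^sub>R \<alpha> i + real q *\<^sub>R \<alpha> j"
    proof (rule rank2_root[OF ij u])
      fix ys assume "foldr s ys = foldr s (u @ [i])"
      then have "foldr s (v @ ys) = foldr s (xs @ [i])" using eq by (simp add: comp_assoc[symmetric])
      from less.prems(2)[OF this] show "length u \<le> length ys" using len by simp
    qed
    then obtain p q :: nat where pq: "foldr s u (\<alpha> i) = real p *\<^sub>R \<alpha> i + real q *\<^sub>R \<alpha> j" by blast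
    have "foldr s xs (\<alpha> i) = foldr s v (foldr s u (\<alpha> i))"
      using eq[symmetric] by simp
    also have "\<dots> = real p *\<^sub>R foldr s v (\<alpha> i) + real q *\<^sub>R foldr s v (\<alpha> j)"
      unfolding pq by (simp add: linear_add[OF linear_word] linear_scale[OF linear_word])
    also have "\<dots> \<in> root_cone"
      by (intro root_cone_add root_cone_scale v_cone) auto
    finally show ?thesis .
  qed
qed

text \<open>Telescoping along a reduced word: x - w s_k x exceeds x - w x by the value of x on the
  k-th coroot times w(\<open>\<alpha> k\<close>), which lies in the cone because w s_k is reduced.
  Here x is arbitrary, so the coefficients may be negative.\<close>

lemma diff_word_decomp:
  "\<exists>\<beta>. (\<forall>i. \<beta> i \<in> root_cone) \<and> x - foldr s xs x = (\<Sum>i\<in>UNIV. blinfun_apply x (\<alpha>v i) *\<^sub>R \<beta> i)"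
proof -
  obtain ys where ys: "reduced ys" "foldr s ys = foldr s xs" using ex_reduced by blast
  have "\<exists>\<beta>. (\<forall>i. \<beta> i \<in> root_cone) \<and> x - foldr s ys x = (\<Sum>i\<in>UNIV. blinfun_apply x (\<alpha>v i) *\<^sub>R \<beta> i)"
    using ys(1)
  proof (induction ys rule: rev_induct)
    case Nil
    show ?case by (intro exI[of _ "\<lambda>_. 0"]) (simp add: root_cone_0)
  next
    case (snoc k ys)
    have red: "reduced ys" using snoc.prems by (rule reduced_appendD)
    then obtain \<beta> where \<beta>: "\<And>i. \<beta> i \<in> root_cone"
      "x - foldr s ys x = (\<Sum>i\<in>UNIV. blinfun_apply x (\<alpha>v i) *\<^sub>R \<beta> i)" using snoc.IH by blast
    have k: "foldr s ys (\<alpha> k) \<in> root_cone"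
      using red by (rule root_positive) (use snoc.prems in \<open>auto simp: reduced_def\<close>)
    let ?\<beta> = "\<lambda>i. \<beta> i + (if i = k then foldr s ys (\<alpha> k) else 0)"
    have "x - foldr s (ys @ [k]) x = (x - foldr s ys x) + blinfun_apply x (\<alpha>v k) *\<^sub>R foldr s ys (\<alpha> k)"
      by (simp add: simple_reflection_def linear_diff[OF linear_word] linear_scale[OF linear_word])
    also have "\<dots> = (\<Sum>i\<in>UNIV. blinfun_apply x (\<alpha>v i) *\<^sub>R ?\<beta> i)"
    proof -
      have "(\<Sum>i\<in>UNIV. blinfun_apply x (\<alpha>v i) *\<^sub>R (if i = k then foldr s ys (\<alpha> k) else 0)) =
          (\<Sum>i\<in>UNIV. if i = k then blinfun_apply x (\<alpha>v i) *\<^sub>R foldr s ys (\<alpha> k) else 0)"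
        by (intro sum.cong) auto
      then show ?thesis unfolding \<beta>(2) by (simp add: scaleR_add_right sum.distrib)
    qed
    finally show ?case
      using \<beta>(1) k root_cone_0 by (intro exI[of _ ?\<beta>]) (auto intro: root_cone_add)
  qed
  then show ?thesis using ys(2) by simp
qed

section \<open>Heights\<close>

text \<open>The simple roots need not span the dual, so an arbitrary linear extension is chosen.
  Differences x - w x lie in their span, where the height is determined.\<close>

definition ht :: "('h \<Rightarrow>\<^sub>L real) \<Rightarrow> real" where
  "ht = (SOME f. linear f \<and> (\<forall>i. f (\<alpha> i) = 1))"

lemma linear_ht: "linear ht" and ht_\<alpha> [simp]: "ht (\<alpha> i) = 1"
proof -
  have "independent (range \<alpha>)" using realization by (simp add: realization_def)
  from linear_independent_extend[OF this, of "\<lambda>_. 1::real"]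
  have "\<exists>f::_ \<Rightarrow> real. linear f \<and> (\<forall>i. f (\<alpha> i) = 1)" by auto
  then have "linear ht \<and> (\<forall>i. ht (\<alpha> i) = 1)" unfolding ht_def by (rule someI_ex)
  then show "linear ht" "ht (\<alpha> i) = 1" by auto
qed

lemma ht_root_cone:
  assumes "x \<in> root_cone"
  obtains n :: nat where "ht x = real n" "n = 0 \<Longrightarrow> x = 0"
proof -
  obtain n :: "'m \<Rightarrow> nat" where x: "x = (\<Sum>i\<in>UNIV. real (n i) *\<^sub>R \<alpha> i)"
    using assms by (auto simp: root_cone_def)
  show ?thesis
  proof
    show "ht x = real (\<Sum>i\<in>UNIV. n i)"
      by (simp add: x linear_sum[OF linear_ht] linear_scale[OF linear_ht])
    show "x = 0" if "(\<Sum>i\<in>UNIV. n i) = 0" using that by (simp add: x)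
  qed
qed

text \<open>The second clause records the equality case: if every term of the height vanishes, then
  so does x - w x.\<close>

lemma ht_diff_word:
  obtains N :: "'m \<Rightarrow> nat" where
    "ht (x - foldr s xs x) = (\<Sum>i\<in>UNIV. blinfun_apply x (\<alpha>v i) * real (N i))"
    "(\<forall>i. blinfun_apply x (\<alpha>v i) * real (N i) = 0) \<longrightarrow> foldr s xs x = x"
proof -
  obtain \<beta> where \<beta>: "\<And>i. \<beta> i \<in> root_cone"
    "x - foldr s xs x = (\<Sum>i\<in>UNIV. blinfun_apply x (\<alpha>v i) *\<^sub>R \<beta> i)"
    using diff_word_decomp by blast
  have "\<forall>i. \<exists>n::nat. ht (\<beta> i) = real n \<and> (n = 0 \<longrightarrow> \<beta> i = 0)"
    using \<beta>(1) ht_root_cone by metis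
  then obtain N :: "'m \<Rightarrow> nat" where N: "\<And>i. ht (\<beta> i) = real (N i)" "\<And>i. N i = 0 \<Longrightarrow> \<beta> i = 0"
    by metis
  show ?thesis
  proof (rule that[OF _ impI])
    show "ht (x - foldr s xs x) = (\<Sum>i\<in>UNIV. blinfun_apply x (\<alpha>v i) * real (N i))"
      by (simp add: \<beta>(2) linear_sum[OF linear_ht] linear_scale[OF linear_ht] N)
    assume "\<forall>i. blinfun_apply x (\<alpha>v i) * real (N i) = 0"
    then have "blinfun_apply x (\<alpha>v i) *\<^sub>R \<beta> i = 0" for i using N(2)[of i] by fastforce
    then have "x - foldr s xs x = 0" unfolding \<beta>(2) by (intro sum.neutral) blast
    then show "foldr s xs x = x" by simp
  qed
qed

lemma dominant_nonneg: "x \<in> fundamental_chamber \<alpha>v \<Longrightarrow> 0 \<le> blinfun_apply x (\<alpha>v i)"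
  by (simp add: fundamental_chamber_def)

text \<open>Each of the two dominant points lies weakly above the other in height, so the height of
  their difference is 0. Its terms are non-negative, hence all zero.\<close>

lemma dominant_conjugate_eq:
  assumes x: "x \<in> fundamental_chamber \<alpha>v" and y: "foldr s xs x \<in> fundamental_chamber \<alpha>v"
  shows "foldr s xs x = x"
proof -
  let ?y = "foldr s xs x"
  have *: "0 \<le> ht (z - foldr s zs z)" if "z \<in> fundamental_chamber \<alpha>v" for z zs
  proof -
    obtain N where "ht (z - foldr s zs z) = (\<Sum>i\<in>UNIV. blinfun_apply z (\<alpha>v i) * real (N i))"
      by (rule ht_diff_word)
    then show ?thesis using that by (simp add: sum_nonneg dominant_nonneg)
  qed
  have "ht (x - ?y) = - ht (?y - x)" by (simp add: linear_diff[OF linear_ht])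
  then have 0: "ht (x - ?y) = 0" using *[OF x, of xs] *[OF y, of "rev xs"] by simp
  obtain N :: "'m \<Rightarrow> nat" where N: "ht (x - ?y) = (\<Sum>i\<in>UNIV. blinfun_apply x (\<alpha>v i) * real (N i))"
    "(\<forall>i. blinfun_apply x (\<alpha>v i) * real (N i) = 0) \<longrightarrow> ?y = x"
    by (rule ht_diff_word)
  have "(\<Sum>i\<in>UNIV. blinfun_apply x (\<alpha>v i) * real (N i)) = 0" using N(1) 0 by simp
  then have "\<forall>i\<in>UNIV. blinfun_apply x (\<alpha>v i) * real (N i) = 0"
    by (subst (asm) sum_nonneg_eq_0_iff) (auto simp: dominant_nonneg[OF x])
  then show ?thesis using N(2) by simp
qed

text \<open>Reflecting in a coroot on which x is negative strictly lowers this height, so a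
  minimiser closed under such reflections is dominant.\<close>

lemma ht_reflect: "ht (\<mu> - s i x) = ht (\<mu> - x) + blinfun_apply x (\<alpha>v i)"
  by (simp add: simple_reflection_def linear_diff[OF linear_ht] linear_scale[OF linear_ht])

lemma weyl_orbit_hull_eq: "weyl_orbit_hull \<alpha> \<alpha>v \<mu> = convex hull (range (\<lambda>xs. foldr s xs \<mu>))"
  by (simp add: weyl_orbit_hull_def weyl_group_eq image_image)

lemma word_weyl_orbit_hull: "foldr s xs ` weyl_orbit_hull \<alpha> \<alpha>v \<mu> = weyl_orbit_hull \<alpha> \<alpha>v \<mu>"
proof -
  have "foldr s xs ` range (\<lambda>ys. foldr s ys \<mu>) = range (\<lambda>ys. foldr s ys \<mu>)"
  proof
    show "foldr s xs ` range (\<lambda>ys. foldr s ys \<mu>) \<subseteq> range (\<lambda>ys. foldr s ys \<mu>)"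
    proof safe
      fix ys show "foldr s xs (foldr s ys \<mu>) \<in> range (\<lambda>ys. foldr s ys \<mu>)"
        by (rule range_eqI[of _ _ "xs @ ys"]) simp
    qed
    show "range (\<lambda>ys. foldr s ys \<mu>) \<subseteq> foldr s xs ` range (\<lambda>ys. foldr s ys \<mu>)"
    proof safe
      fix ys
      have "foldr s ys \<mu> = foldr s xs (foldr s (rev xs @ ys) \<mu>)" by simp
      then show "foldr s ys \<mu> \<in> foldr s xs ` range (\<lambda>ys. foldr s ys \<mu>)" by blast
    qed
  qed
  then show ?thesis
    unfolding weyl_orbit_hull_eq by (metis convex_hull_linear_image linear_word)
qed

text \<open>The points with this property form a convex set containing the orbit of \<mu>, hence the
  hull. On the orbit the heights are natural combinations of the values of \<mu> on the
  coroots.\<close>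

lemma orbit_heights_locally_finite:
  assumes \<mu>: "\<mu> \<in> fundamental_chamber \<alpha>v" and x: "x \<in> weyl_orbit_hull \<alpha> \<alpha>v \<mu>"
  shows "locally_finite_nonneg (range (\<lambda>xs. ht (\<mu> - foldr s xs x)))"
proof -
  let ?P = "\<lambda>x. locally_finite_nonneg (range (\<lambda>xs. ht (\<mu> - foldr s xs x)))"
  have "weyl_orbit_hull \<alpha> \<alpha>v \<mu> \<subseteq> {x. ?P x}"
    unfolding weyl_orbit_hull_eq
  proof (rule hull_minimal)
    show "range (\<lambda>xs. foldr s xs \<mu>) \<subseteq> {x. ?P x}"
    proof safe
      fix ys
      show "?P (foldr s ys \<mu>)"
      proof (rule locally_finite_nonneg_subset)
        show "locally_finite_nonneg
            (range (\<lambda>N::'m \<Rightarrow> nat. \<Sum>i\<in>UNIV. blinfun_apply \<mu> (\<alpha>v i) * real (N i)))"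
          by (rule locally_finite_nonneg_nat_combinations) (simp_all add: dominant_nonneg[OF \<mu>])
        show "range (\<lambda>xs. ht (\<mu> - foldr s xs (foldr s ys \<mu>))) \<subseteq> \<dots>"
        proof safe
          fix xs
          obtain N where "ht (\<mu> - foldr s (xs @ ys) \<mu>) =
              (\<Sum>i\<in>UNIV. blinfun_apply \<mu> (\<alpha>v i) * real (N i))" by (rule ht_diff_word)
          then show "ht (\<mu> - foldr s xs (foldr s ys \<mu>)) \<in>
              range (\<lambda>N::'m \<Rightarrow> nat. \<Sum>i\<in>UNIV. blinfun_apply \<mu> (\<alpha>v i) * real (N i))"
            by (intro range_eqI[of _ _ N]) simp
        qed
      qed
    qed
    show "convex {x. ?P x}"
    proof (rule convexI, safe)
      fix x y :: "'h \<Rightarrow>\<^sub>L real" and u v :: real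
      assume "?P x" "?P y" and uv: "0 \<le> u" "0 \<le> v" "u + v = 1"
      let ?X = "(*) u ` range (\<lambda>xs. ht (\<mu> - foldr s xs x))"
      let ?Y = "(*) v ` range (\<lambda>xs. ht (\<mu> - foldr s xs y))"
      have "locally_finite_nonneg {s + t | s t. s \<in> ?X \<and> t \<in> ?Y}"
        using \<open>?P x\<close> \<open>?P y\<close> uv by (intro locally_finite_nonneg_add locally_finite_nonneg_scale)
      moreover have "ht (\<mu> - foldr s xs (u *\<^sub>R x + v *\<^sub>R y)) =
          u * ht (\<mu> - foldr s xs x) + v * ht (\<mu> - foldr s xs y)" for xs
      proof -
        \<comment> \<open>Splitting the height of \<mu> by the weights puts each height of the
          combination into the sumset of the scaled heights, with the same word for both
          points.\<close>
        have "ht \<mu> = (u + v) * ht \<mu>" using uv by simp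
        then show ?thesis
          by (simp add: linear_add[OF linear_word] linear_scale[OF linear_word]
              linear_diff[OF linear_ht] linear_add[OF linear_ht] linear_scale[OF linear_ht]
              algebra_simps)
      qed
      then have "range (\<lambda>xs. ht (\<mu> - foldr s xs (u *\<^sub>R x + v *\<^sub>R y))) \<subseteq>
          {s + t | s t. s \<in> ?X \<and> t \<in> ?Y}" by auto
      ultimately show "?P (u *\<^sub>R x + v *\<^sub>R y)" by (rule locally_finite_nonneg_subset)
    qed
  qed
  with x show ?thesis by blast
qed

section \<open>Fundamental faces\<close>

lemma rel_interior_word_image: "rel_interior (foldr s xs ` S) = foldr s xs ` rel_interior S"
  by (rule rel_interior_linear_iso[OF bounded_linear_word bounded_linear_word[of "rev xs"]]) auto

lemma inj_word: "inj (foldr s xs)"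
  by (rule inj_on_inverseI[of _ "foldr s (rev xs)"]) simp

lemma face_of_word_image:
  "F face_of weyl_orbit_hull \<alpha> \<alpha>v \<mu> \<Longrightarrow> foldr s xs ` F face_of weyl_orbit_hull \<alpha> \<alpha>v \<mu>"
  using face_of_linear_image[OF linear_word inj_word, of xs F "weyl_orbit_hull \<alpha> \<alpha>v \<mu>"]
  by (simp add: word_weyl_orbit_hull)

text \<open>
  The predicate \<open>Q\<close> is trivial when producing a fundamental face, and the stabiliser of a face
  when proving uniqueness.
\<close>

lemma ex_dominant_conjugate:
  assumes \<mu>: "\<mu> \<in> fundamental_chamber \<alpha>v" and x: "x \<in> weyl_orbit_hull \<alpha> \<alpha>v \<mu>"
    and Q: "Q xs\<^sub>0"
    and reflect: "\<And>xs i. Q xs \<Longrightarrow> blinfun_apply (foldr s xs x) (\<alpha>v i) < 0 \<Longrightarrow> Q (i # xs)"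
  shows "\<exists>xs. Q xs \<and> foldr s xs x \<in> fundamental_chamber \<alpha>v"
proof -
  let ?S = "(\<lambda>xs. ht (\<mu> - foldr s xs x)) ` {xs. Q xs}"
  have "locally_finite_nonneg ?S"
    using orbit_heights_locally_finite[OF \<mu> x] by (rule locally_finite_nonneg_subset) auto
  moreover have "?S \<noteq> {}" using Q by auto
  ultimately obtain h where "h \<in> ?S" and min: "\<And>y. y \<in> ?S \<Longrightarrow> h \<le> y"
    using locally_finite_nonneg_has_min by metis
  then obtain xs where xs: "Q xs" "h = ht (\<mu> - foldr s xs x)" by auto
  have "0 \<le> blinfun_apply (foldr s xs x) (\<alpha>v i)" for i
  proof (rule ccontr)
    assume neg: "\<not> 0 \<le> blinfun_apply (foldr s xs x) (\<alpha>v i)"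
    then have "Q (i # xs)" using reflect xs(1) by simp
    then have "h \<le> ht (\<mu> - foldr s (i # xs) x)" using min by blast
    then show False using neg xs(2) by (simp add: ht_reflect)
  qed
  then show ?thesis using xs(1) by (auto simp: fundamental_chamber_def)
qed

lemma reflection_stabilizes_face:
  assumes G: "G face_of weyl_orbit_hull \<alpha> \<alpha>v \<mu>"
    and x: "x \<in> rel_interior G" "0 \<le> blinfun_apply x (\<alpha>v i)"
    and z: "z \<in> rel_interior G" "blinfun_apply z (\<alpha>v i) < 0"
  shows "s i ` G = G"
proof -
  let ?a = "blinfun_apply x (\<alpha>v i)" and ?b = "blinfun_apply z (\<alpha>v i)"
  \<comment> \<open>This parameter is where the segment from x to z meets the reflecting hyperplane;
    the denominator is positive because \<open>?a\<close> is non-negative and \<open>?b\<close>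
    negative.\<close>
  define t where "t = ?a / (?a - ?b)"
  have t01: "0 \<le> t" "t \<le> 1" and "t * (?a - ?b) = ?a"
    using x(2) z(2) by (simp_all add: t_def)
  then have t: "(1 - t) * ?a + t * ?b = 0" by (simp add: algebra_simps)
  define p where "p = (1 - t) *\<^sub>R x + t *\<^sub>R z"
  have "convex (rel_interior G)"
    using G by (simp add: convex_rel_interior_dual face_of_imp_convex)
  then have p: "p \<in> rel_interior G"
    using x(1) z(1) t01 unfolding p_def by (rule convexD_alt)
  have "blinfun_apply p (\<alpha>v i) = 0"
    unfolding p_def using t by (simp only: blinfun.add_left blinfun.scaleR_left real_scaleR_def)
  then have "s i p = p" by (simp add: simple_reflection_def)
  then have "p \<in> rel_interior (s i ` G)"
    using imageI[OF p, of "s i"] rel_interior_word_image[of "[i]" G] by simp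
  moreover have "s i ` G face_of weyl_orbit_hull \<alpha> \<alpha>v \<mu>"
    using face_of_word_image[OF G, of "[i]"] by simp
  ultimately show ?thesis
    using p face_of_eq[OF _ G] by blast
qed

lemma fundamental_face_representative:
  assumes \<mu>: "\<mu> \<in> fundamental_chamber \<alpha>v" and F: "F face_of weyl_orbit_hull \<alpha> \<alpha>v \<mu>"
  shows "\<exists>xs. fundamental_face \<alpha>v (weyl_orbit_hull \<alpha> \<alpha>v \<mu>) (foldr s xs ` F)"
proof (cases "F = {}")
  case True
  then show ?thesis by (auto simp: fundamental_face_def)
next
  case False
  then obtain x where x: "x \<in> rel_interior F"
    using rel_interior_eq_empty_dual[OF face_of_imp_convex[OF F]] by auto
  then have "x \<in> weyl_orbit_hull \<alpha> \<alpha>v \<mu>"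
    using F rel_interior_subset face_of_imp_subset by blast
  from ex_dominant_conjugate[OF \<mu> this, of "\<lambda>_. True"]
  obtain xs where "foldr s xs x \<in> fundamental_chamber \<alpha>v" by blast
  moreover have "foldr s xs x \<in> rel_interior (foldr s xs ` F)"
    using x by (simp add: rel_interior_word_image)
  ultimately show ?thesis
    using face_of_word_image[OF F] by (auto simp: fundamental_face_def)
qed

lemma fundamental_face_unique:
  assumes \<mu>: "\<mu> \<in> fundamental_chamber \<alpha>v"
    and G: "fundamental_face \<alpha>v (weyl_orbit_hull \<alpha> \<alpha>v \<mu>) G"
    and G': "fundamental_face \<alpha>v (weyl_orbit_hull \<alpha> \<alpha>v \<mu>) (foldr s xs ` G)"
  shows "foldr s xs ` G = G"
proof (cases "G = {}")
  case False
  let ?G' = "foldr s xs ` G"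
  obtain x where x: "x \<in> rel_interior G" "x \<in> fundamental_chamber \<alpha>v"
    using G False by (auto simp: fundamental_face_def)
  obtain x' where x': "x' \<in> rel_interior ?G'" "x' \<in> fundamental_chamber \<alpha>v"
    using G' False by (auto simp: fundamental_face_def)
  have faces: "G face_of weyl_orbit_hull \<alpha> \<alpha>v \<mu>" "?G' face_of weyl_orbit_hull \<alpha> \<alpha>v \<mu>"
    using G G' by (simp_all add: fundamental_face_def)
  let ?y = "foldr s xs x"
  have y: "?y \<in> rel_interior ?G'" using x by (simp add: rel_interior_word_image)
  then have yH: "?y \<in> weyl_orbit_hull \<alpha> \<alpha>v \<mu>"
    using faces(2) rel_interior_subset face_of_imp_subset by blast
  have "\<exists>us. foldr s us ` ?G' = ?G' \<and> foldr s us ?y \<in> fundamental_chamber \<alpha>v"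
  \<comment> \<open>The search runs over words stabilising \<open>?G'\<close>, starting from the
    empty one. A stabilising word keeps the point in the relative interior, where the negative value
    makes the next reflection stabilise the face too.\<close>
  proof (rule ex_dominant_conjugate[OF \<mu> yH, of _ "[]"])
    fix us i
    assume us: "foldr s us ` ?G' = ?G'" and neg: "blinfun_apply (foldr s us ?y) (\<alpha>v i) < 0"
    have "foldr s us ?y \<in> rel_interior ?G'" using y us rel_interior_word_image by (metis imageI)
    then have "s i ` ?G' = ?G'"
      using reflection_stabilizes_face[OF faces(2) x'(1) dominant_nonneg[OF x'(2)]] neg by blast
    then show "foldr s (i # us) ` ?G' = ?G'" using us by (metis foldr_Cons image_comp)
  qed simp
  then obtain us where us: "foldr s us ` ?G' = ?G'" "foldr s us ?y \<in> fundamental_chamber \<alpha>v" by blast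
  have "foldr s us ?y = x"
    using dominant_conjugate_eq[OF x(2), of "us @ xs"] us(2) by simp
  moreover have "foldr s us ?y \<in> rel_interior ?G'"
    using y us(1) rel_interior_word_image by (metis imageI)
  ultimately show ?thesis using face_of_eq[OF faces(2,1)] x(1) by auto
qed simp

end

theorem corollary3p17:
  fixes A :: "int^'m^'m"
    and \<alpha> :: "'m \<Rightarrow> 'h::euclidean_space \<Rightarrow>\<^sub>L real"
    and \<alpha>v :: "'m \<Rightarrow> 'h"
    and \<mu> :: "'h \<Rightarrow>\<^sub>L real"
    and H :: "('h \<Rightarrow>\<^sub>L real) set"
  assumes "generalized_cartan_matrix A"
    and "realization A \<alpha> \<alpha>v"
    and "\<mu> \<in> fundamental_chamber \<alpha>v"
    and "H = weyl_orbit_hull \<alpha> \<alpha>v \<mu>"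
  shows "\<forall>F. F face_of H \<longrightarrow>
    (\<exists>!G. fundamental_face \<alpha>v H G \<and> (\<exists>w \<in> weyl_group \<alpha> \<alpha>v. G = w ` F))"
proof (intro allI impI)
  fix F assume F: "F face_of H"
  interpret gcm_realization A \<alpha> \<alpha>v using assms(1,2) by unfold_locales
  obtain xs where xs: "fundamental_face \<alpha>v H (foldr s xs ` F)"
    using fundamental_face_representative assms(3,4) F by blast
  show "\<exists>!G. fundamental_face \<alpha>v H G \<and> (\<exists>w \<in> weyl_group \<alpha> \<alpha>v. G = w ` F)"
  proof (rule ex1I)
    show "fundamental_face \<alpha>v H (foldr s xs ` F) \<and> (\<exists>w \<in> weyl_group \<alpha> \<alpha>v. foldr s xs ` F = w ` F)"
      using xs by (auto simp: weyl_group_eq)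
    fix G assume "fundamental_face \<alpha>v H G \<and> (\<exists>w \<in> weyl_group \<alpha> \<alpha>v. G = w ` F)"
    then obtain ys where G: "fundamental_face \<alpha>v H G" "G = foldr s ys ` F"
      by (auto simp: weyl_group_eq)
    \<comment> \<open>Undoing \<open>xs\<close> and then applying \<open>ys\<close> carries one
      fundamental representative to the other, so uniqueness applies to the pair.\<close>
    have "foldr s (ys @ rev xs) ` foldr s xs ` F = G"
      by (simp add: G(2) image_image)
    then show "G = foldr s xs ` F"
      using fundamental_face_unique[OF assms(3), of "foldr s xs ` F" "ys @ rev xs"] xs G(1) assms(4)
      by simp
  qed
qed

end
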